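(* Let $G$ be a finite group acting on a finite nonempty set $X$. Let $A$ be the $G^*\times X$ matrix and $B$ the $X\times G^*$ matrix with entries $$A(g,x):=\frac{\mathbf 1_{\{x\in X_g\}}}{|X_g|},\qquad B(x,h):=\frac{\mathbf 1_{\{h\in G_x\}}}{|G_x|}.$$ Then $Q=AB$ and $K=BA$, where $Q$ is the dual Burnside kernel on $G^*$ and $K$ is the classical Burnside kernel on $X$.
   Context: For $g\in G$ and $x\in X$ write $X_g:=\{x\in X: g\cdot x=x\}$, $G_x:=\{g\in G: g\cdot x=x\}$, and $G^*:=\{g\in G: X_g\neq\varnothing\}$. The classical Burnside kernel on $X$ is $$K(x,y)=\frac1{|G_x|}\sum_{g\in G_x\cap G_y}\frac1{|X_g|}\qquad(x,y\in X),$$ and the dual Burnside kernel on $G^*$ is $$Q(g,h)=\frac1{|X_g|}\sum_{x\in X_g\cap X_h}\frac1{|G_x|}\qquad(g,h\in G^* ).$$ *)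

theory Defs
  imports Complex_Main "HOL-Library.Indicator_Function" "HOL-Algebra.Group_Action"
begin

text \<open>
  For an action \<open>\<phi>\<close> of \<open>G\<close> on \<open>X\<close>, the fixed-point set of \<open>g\<close> is \<open>invariants X \<phi> g\<close> and the
  isotropy group of \<open>x\<close> is \<open>stabilizer G \<phi> x\<close>, both from the library.
\<close>

definition fixing_elements :: "('g, 'm) monoid_scheme \<Rightarrow> 'x set \<Rightarrow> ('g \<Rightarrow> 'x \<Rightarrow> 'x) \<Rightarrow> 'g set" where
  "fixing_elements G X \<phi> = {g \<in> carrier G. invariants X \<phi> g \<noteq> {}}"

text \<open>
  A real matrix with rows indexed by a set \<open>I\<close> and columns indexed by a set \<open>J\<close> is a curried
  function that is extensional in both arguments, so that equality of two \<open>I \<times> J\<close> matrices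
  means equality of their entries on \<open>I \<times> J\<close>.  In \<open>matrix_prod I J K M N\<close>, \<open>M\<close> is an
  \<open>I \<times> J\<close> matrix and \<open>N\<close> a \<open>J \<times> K\<close> matrix.
\<close>

definition matrix_prod ::
  "'i set \<Rightarrow> 'j set \<Rightarrow> 'k set \<Rightarrow> ('i \<Rightarrow> 'j \<Rightarrow> real) \<Rightarrow> ('j \<Rightarrow> 'k \<Rightarrow> real) \<Rightarrow> 'i \<Rightarrow> 'k \<Rightarrow> real" where
  "matrix_prod I J K M N = (\<lambda>i\<in>I. \<lambda>k\<in>K. \<Sum>j\<in>J. M i j * N j k)"

definition burnside_kernel ::
  "('g, 'm) monoid_scheme \<Rightarrow> 'x set \<Rightarrow> ('g \<Rightarrow> 'x \<Rightarrow> 'x) \<Rightarrow> 'x \<Rightarrow> 'x \<Rightarrow> real" where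
  "burnside_kernel G X \<phi> = (\<lambda>x\<in>X. \<lambda>y\<in>X.
     1 / real (card (stabilizer G \<phi> x)) *
     (\<Sum>g \<in> stabilizer G \<phi> x \<inter> stabilizer G \<phi> y. 1 / real (card (invariants X \<phi> g))))"

definition dual_burnside_kernel ::
  "('g, 'm) monoid_scheme \<Rightarrow> 'x set \<Rightarrow> ('g \<Rightarrow> 'x \<Rightarrow> 'x) \<Rightarrow> 'g \<Rightarrow> 'g \<Rightarrow> real" where
  "dual_burnside_kernel G X \<phi> = (\<lambda>g\<in>fixing_elements G X \<phi>. \<lambda>h\<in>fixing_elements G X \<phi>.
     1 / real (card (invariants X \<phi> g)) *
     (\<Sum>x \<in> invariants X \<phi> g \<inter> invariants X \<phi> h. 1 / real (card (stabilizer G \<phi> x))))"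

definition fixed_point_matrix ::
  "('g, 'm) monoid_scheme \<Rightarrow> 'x set \<Rightarrow> ('g \<Rightarrow> 'x \<Rightarrow> 'x) \<Rightarrow> 'g \<Rightarrow> 'x \<Rightarrow> real" where
  "fixed_point_matrix G X \<phi> = (\<lambda>g\<in>fixing_elements G X \<phi>. \<lambda>x\<in>X.
     indicator (invariants X \<phi> g) x / real (card (invariants X \<phi> g)))"

definition stabilizer_matrix ::
  "('g, 'm) monoid_scheme \<Rightarrow> 'x set \<Rightarrow> ('g \<Rightarrow> 'x \<Rightarrow> 'x) \<Rightarrow> 'x \<Rightarrow> 'g \<Rightarrow> real" where
  "stabilizer_matrix G X \<phi> = (\<lambda>x\<in>X. \<lambda>h\<in>fixing_elements G X \<phi>.
     indicator (stabilizer G \<phi> x) h / real (card (stabilizer G \<phi> x)))"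

end

theory Submission
  imports Defs
begin

text \<open>Both identities are one computation on the incidence relation
  \<open>\<phi> g x = x\<close>, read either as x in X_g or as g in G_x
  (\<open>mem_invariants_iff_mem_stabilizer\<close>). In an entry of AB or BA the two indicators
  multiply to the indicator of the intersection over which the kernel sums, and the outer
  normalisation is constant in the summation index (\<open>sum_indicator_quotient_product\<close>).
  For BA the sum runs over G^* only; this loses nothing, since every stabilizer lies in G^*
  (\<open>stabilizer_subset_fixing_elements\<close>).\<close>

lemma mem_invariants_iff_mem_stabilizer:
  assumes "g \<in> carrier G" and "x \<in> X"
  shows "x \<in> invariants X \<phi> g \<longleftrightarrow> g \<in> stabilizer G \<phi> x"
  using assms by (simp add: invariants_def stabilizer_def)

lemma stabilizer_subset_fixing_elements:
  assumes "x \<in> X"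
  shows "stabilizer G \<phi> x \<subseteq> fixing_elements G X \<phi>"
  using assms by (auto simp: stabilizer_def fixing_elements_def invariants_def)

text \<open>Extending the sum by zero from \<open>S \<inter> T\<close> to \<open>J\<close> turns
  membership into a product of indicators. The family \<open>V\<close> is the incidence seen from
  the other side: the second matrix tests \<open>b \<in> V j\<close>, whereas the kernel tests
  \<open>j \<in> T\<close>.\<close>

lemma sum_indicator_quotient_product:
  fixes c :: real and d :: "'j \<Rightarrow> real"
  assumes "finite J" and "S \<inter> T \<subseteq> J" and "\<And>j. j \<in> J \<Longrightarrow> b \<in> V j \<longleftrightarrow> j \<in> T"
  shows "1 / c * (\<Sum>j\<in>S \<inter> T. 1 / d j) =
    (\<Sum>j\<in>J. indicator S j / c * (indicator (V j) b / d j))"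
proof -
  have "(\<Sum>j\<in>S \<inter> T. 1 / d j) = (\<Sum>j\<in>J. if j \<in> S \<inter> T then 1 / d j else 0)"
    using assms(1,2) by (intro sum.mono_neutral_cong_left) auto
  then show ?thesis
    using assms(3) by (auto simp: sum_distrib_left intro!: sum.cong split: split_indicator)
qed

theorem lemma3p5:
  fixes G :: "('g, 'm) monoid_scheme" and X :: "'x set" and \<phi> :: "'g \<Rightarrow> 'x \<Rightarrow> 'x"
  assumes "group_action G X \<phi>"
    and "finite (carrier G)"
    and "finite X"
    and "X \<noteq> {}"
  shows "dual_burnside_kernel G X \<phi> =
           matrix_prod (fixing_elements G X \<phi>) X (fixing_elements G X \<phi>)
             (fixed_point_matrix G X \<phi>) (stabilizer_matrix G X \<phi>)
       \<and> burnside_kernel G X \<phi> =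
           matrix_prod X (fixing_elements G X \<phi>) X
             (stabilizer_matrix G X \<phi>) (fixed_point_matrix G X \<phi>)"
proof
  let ?F = "fixing_elements G X \<phi>"
  have carrier: "g \<in> carrier G" if "g \<in> ?F" for g
    using that by (simp add: fixing_elements_def)
  have fin: "finite ?F"
    using assms(2) by (simp add: fixing_elements_def)
  show "dual_burnside_kernel G X \<phi> =
      matrix_prod ?F X ?F (fixed_point_matrix G X \<phi>) (stabilizer_matrix G X \<phi>)"
    unfolding dual_burnside_kernel_def matrix_prod_def
  proof (intro restrict_ext)
    fix g h assume g: "g \<in> ?F" and h: "h \<in> ?F"
    have "invariants X \<phi> g \<inter> invariants X \<phi> h \<subseteq> X"
      by (auto simp: invariants_def)
    \<comment> \<open>Here \<open>S\<close> and \<open>T\<close> are the fixed-point sets of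
      \<open>g\<close> and \<open>h\<close>. The premise still open, h in G_x iff x in X_h for x in
      \<open>X\<close>, is the incidence duality.\<close>
    from sum_indicator_quotient_product [OF assms(3) this, of h "stabilizer G \<phi>"]
    show "1 / real (card (invariants X \<phi> g)) *
        (\<Sum>x\<in>invariants X \<phi> g \<inter> invariants X \<phi> h. 1 / real (card (stabilizer G \<phi> x))) =
        (\<Sum>x\<in>X. fixed_point_matrix G X \<phi> g x * stabilizer_matrix G X \<phi> x h)"
      using g h by (simp add: fixed_point_matrix_def stabilizer_matrix_def
          mem_invariants_iff_mem_stabilizer [OF carrier])
  qed
  show "burnside_kernel G X \<phi> =
      matrix_prod X ?F X (stabilizer_matrix G X \<phi>) (fixed_point_matrix G X \<phi>)"
    unfolding burnside_kernel_def matrix_prod_def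
  proof (intro restrict_ext)
    fix x y assume x: "x \<in> X" and y: "y \<in> X"
    have "stabilizer G \<phi> x \<inter> stabilizer G \<phi> y \<subseteq> ?F"
      using stabilizer_subset_fixing_elements [OF x, of G \<phi>] by blast
    \<comment> \<open>The same with the roles exchanged: \<open>S\<close> and \<open>T\<close> are
      the stabilizers of \<open>x\<close> and \<open>y\<close>, and \<open>V\<close> is the family
      of fixed-point sets.\<close>
    from sum_indicator_quotient_product [OF fin this, of y "invariants X \<phi>"]
    show "1 / real (card (stabilizer G \<phi> x)) *
        (\<Sum>g\<in>stabilizer G \<phi> x \<inter> stabilizer G \<phi> y. 1 / real (card (invariants X \<phi> g))) =
        (\<Sum>g\<in>?F. stabilizer_matrix G X \<phi> x g * fixed_point_matrix G X \<phi> g y)"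
      using x y by (simp add: fixed_point_matrix_def stabilizer_matrix_def
          mem_invariants_iff_mem_stabilizer [OF carrier])
  qed
qed

end
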